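(* If $D$ is a sourceless digraph with $n$ vertices and maximum out-degree $\Delta^+(D)\le 3$, then $D$ contains a quasi-kernel of order at most $\frac{4n}{7}$.
   Context: Digraphs are finite, without loops and without repeated edges $(u,v)$; both $(u,v)$ and $(v,u)$ may be present. A source is a vertex with in-degree zero; a digraph is sourceless if it has no source. $\dist(v,u)$ is the length of a shortest directed path from $v$ to $u$ ($\infty$ if none exists). A quasi-kernel of $D$ is an independent set $Q$ (no edges in either direction between vertices of $Q$) such that for every vertex $u$ of $D$ there is $v\in Q$ with $\dist(v,u)\le 2$. *)

theory Defs
  imports "Graph_Theory.Arc_Walk" "HOL-Library.Extended_Nat" Complex_Main
begin

definition source :: "('a,'b) pre_digraph \<Rightarrow> 'a \<Rightarrow> bool" where
  "source G v \<longleftrightarrow> v \<in> verts G \<and> in_degree G v = 0"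

definition sourceless :: "('a,'b) pre_digraph \<Rightarrow> bool" where
  "sourceless G \<longleftrightarrow> (\<nexists>v. source G v)"

(* On nat, Sup is the maximum of a nonempty finite set, and 0 for the empty set;
   so the digraph without vertices has maximum out-degree 0. *)
definition max_out_degree :: "('a,'b) pre_digraph \<Rightarrow> nat" where
  "max_out_degree G = (SUP v\<in>verts G. out_degree G v)"

(* The infimum over the empty set is \<infinity>, which is the value when no path exists.
   The trivial path gives ddist G v v = 0 for a vertex v. *)
definition ddist :: "('a,'b) pre_digraph \<Rightarrow> 'a \<Rightarrow> 'a \<Rightarrow> enat" where
  "ddist G v u = (INF p\<in>{p. pre_digraph.apath G v p u}. enat (length p))"

definition independent_set :: "('a,'b) pre_digraph \<Rightarrow> 'a set \<Rightarrow> bool" where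
  "independent_set G Q \<longleftrightarrow>
     Q \<subseteq> verts G \<and> (\<forall>u\<in>Q. \<forall>v\<in>Q. \<not> u \<rightarrow>\<^bsub>G\<^esub> v)"

definition quasi_kernel :: "('a,'b) pre_digraph \<Rightarrow> 'a set \<Rightarrow> bool" where
  "quasi_kernel G Q \<longleftrightarrow>
     independent_set G Q \<and> (\<forall>u\<in>verts G. \<exists>v\<in>Q. ddist G v u \<le> 2)"

end

theory Submission
  imports Defs
begin

text \<open>Write \<open>d\<close> for out-degree. Allowing sources, one proves by induction on \<open>n\<close> the bound
  \<open>7 |Q| + 4 |N\<^sup>+(S)| \<le> 4 n + 3 |S|\<close>, where \<open>S\<close> is the set of sources. If \<open>S\<close> is nonempty, delete
  \<open>S \<union> N\<^sup>+(S)\<close>: the new sources are at distance 2 from \<open>S\<close>, so of those one keeps only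
  enough to dominate their out-neighbours. If there are no sources, follow Chvatal and Lovasz:
  delete \<open>v\<close> and its out-neighbourhood, and take a quasi-kernel \<open>Q'\<close> of the rest; either some
  vertex of \<open>Q'\<close> dominates \<open>v\<close> and \<open>Q'\<close> itself works, or \<open>v\<close> is added and the new sources are
  thinned out as before. The first case needs that the deletion creates at most
  \<open>4 (1 + d(v)) / 3\<close> sources.

  Such a \<open>v\<close> exists by averaging. Let \<open>g(v)\<close> be the sum of \<open>1 / indeg(x)\<close> over the
  out-neighbours \<open>x\<close> of \<open>v\<close>, and \<open>f = max(0, g - 1)\<close>. The number of sources created at \<open>v\<close> is at
  most the sum of \<open>g\<close> over its out-neighbours. If it is always too large, then out-degree at
  most 3 forces \<open>f(v)\<close> to be less than the sum of \<open>f(x) / indeg(x)\<close> over the out-neighbours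
  \<open>x\<close> of \<open>v\<close>; but summed over all \<open>v\<close> the two sides agree.\<close>

section \<open>Digraphs as a relation with a vertex set\<close>

text \<open>The relation \<open>E\<close> stays fixed throughout, so passing to an induced
  subdigraph only shrinks \<open>V\<close>.\<close>

definition out_nbrs :: "('a \<Rightarrow> 'a \<Rightarrow> bool) \<Rightarrow> 'a set \<Rightarrow> 'a \<Rightarrow> 'a set" where
  "out_nbrs E V v = {u \<in> V. E v u}"

definition in_nbrs :: "('a \<Rightarrow> 'a \<Rightarrow> bool) \<Rightarrow> 'a set \<Rightarrow> 'a \<Rightarrow> 'a set" where
  "in_nbrs E V v = {u \<in> V. E u v}"

definition sources :: "('a \<Rightarrow> 'a \<Rightarrow> bool) \<Rightarrow> 'a set \<Rightarrow> 'a set" where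
  "sources E V = {v \<in> V. \<forall>u\<in>V. \<not> E u v}"

definition covers :: "('a \<Rightarrow> 'a \<Rightarrow> bool) \<Rightarrow> 'a set \<Rightarrow> 'a set \<Rightarrow> 'a \<Rightarrow> bool" where
  "covers E V Q u \<longleftrightarrow> (\<exists>q\<in>Q. q = u \<or> E q u \<or> (\<exists>x\<in>V. E q x \<and> E x u))"

definition rel_quasi_kernel :: "('a \<Rightarrow> 'a \<Rightarrow> bool) \<Rightarrow> 'a set \<Rightarrow> 'a set \<Rightarrow> bool" where
  "rel_quasi_kernel E V Q \<longleftrightarrow>
     Q \<subseteq> V \<and> (\<forall>u\<in>Q. \<forall>v\<in>Q. \<not> E u v) \<and> (\<forall>u\<in>V. covers E V Q u)"

lemma covers_mono: "covers E V Q u \<Longrightarrow> V \<subseteq> V' \<Longrightarrow> Q \<subseteq> Q' \<Longrightarrow> covers E V' Q' u"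
  unfolding covers_def by blast

section \<open>Thinning out the sources\<close>

lemma small_dominating_subset:
  assumes "finite T" "\<And>t. t \<in> T \<Longrightarrow> \<exists>s\<in>S. E s t"
  obtains S' where "S' \<subseteq> S" "card S' \<le> card T" "\<And>t. t \<in> T \<Longrightarrow> \<exists>s\<in>S'. E s t"
proof -
  obtain f where f: "\<And>t. t \<in> T \<Longrightarrow> f t \<in> S \<and> E (f t) t"
    using assms(2) by metis
  show thesis
  proof (rule that[of "f ` T"])
    show "card (f ` T) \<le> card T" using assms(1) by (rule card_image_le)
  qed (use f in auto)
qed

text \<open>Sources have to lie in every quasi-kernel; once they are covered from outside,
  only those that are needed to dominate their out-neighbours must be kept.\<close>
lemma trim_sources:
  assumes fin: "finite R" and Q: "rel_quasi_kernel E R Q"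
    and bound: "7 * card Q + 4 * card (\<Union>s\<in>sources E R. out_nbrs E R s)
      \<le> 4 * card R + 3 * card (sources E R)"
  obtains P where "P \<subseteq> Q" "7 * card P \<le> 4 * card R"
    "\<And>u. u \<in> R - sources E R \<Longrightarrow> covers E R P u"
proof -
  define S where "S = sources E R"
  define T where "T = (\<Union>s\<in>S. out_nbrs E R s)"
  have QR: "Q \<subseteq> R" and cov: "\<And>u. u \<in> R \<Longrightarrow> covers E R Q u"
    using Q by (auto simp: rel_quasi_kernel_def)
  have finQ: "finite Q" using QR fin finite_subset by blast
  \<comment> \<open>Nothing in \<open>R\<close> dominates a source, so only the source itself can
    cover it.\<close>
  have SQ: "S \<subseteq> Q"
    using cov QR unfolding S_def sources_def covers_def by blast
  have "finite T" using fin by (rule finite_subset[rotated]) (auto simp: T_def out_nbrs_def)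
  then obtain S' where S': "S' \<subseteq> S" "card S' \<le> card T" "\<And>t. t \<in> T \<Longrightarrow> \<exists>s\<in>S'. E s t"
    by (rule small_dominating_subset[of T S E]) (auto simp: T_def out_nbrs_def)
  define P where "P = (Q - S) \<union> S'"
  have finS: "finite S" using SQ finQ finite_subset by blast
  have "card P \<le> card (Q - S) + card S'" unfolding P_def by (rule card_Un_le)
  moreover have "card (Q - S) = card Q - card S" "card S \<le> card Q"
    using SQ finQ finS by (auto simp: card_Diff_subset card_mono)
  moreover have "card S' \<le> card S" using S'(1) finS by (rule card_mono[rotated])
  moreover have "7 * card Q + 4 * card T \<le> 4 * card R + 3 * card S"
    using bound by (simp add: S_def T_def)
  \<comment> \<open>As |S'| is at most |S| and at most |T|: 7|P| <= 7|Q| - 7|S| + 7|S'| <= 4|R| -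
    4|S| - 4|T| + 7|S'| <= 4|R|.\<close>
  ultimately have "7 * card P \<le> 4 * card R" using S'(2) by linarith
  moreover have "covers E R P u" if u: "u \<in> R - S" for u
  proof -
    obtain q where q: "q \<in> Q" "q = u \<or> E q u \<or> (\<exists>x\<in>R. E q x \<and> E x u)"
      using cov[of u] u by (auto simp: covers_def)
    show ?thesis
    proof (cases "q \<in> S")
      case False
      then show ?thesis using q by (auto simp: covers_def P_def)
    next
      case True
      \<comment> \<open>Since \<open>u\<close> is not in \<open>S\<close>, the path from
        \<open>q\<close> starts with an edge into \<open>T\<close>, and \<open>S'\<close> dominates
        \<open>T\<close> as well.\<close>
      then have "u \<in> T \<or> (\<exists>x\<in>T. E x u)"
        using q(2) u by (auto simp: T_def out_nbrs_def)
      then show ?thesis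
        using S'(3) fin unfolding covers_def P_def T_def out_nbrs_def by blast
    qed
  qed
  ultimately show thesis
    using that[of P] SQ S'(1) by (auto simp: P_def S_def)
qed

section \<open>Averaging with reciprocal in-degrees\<close>

text \<open>The local inequality for the averaging: \<open>X\<close> will be an out-neighbourhood
  and \<open>y\<close> the reciprocal in-degrees. Besides positivity of the right side, the sum of
  \<open>y x * (f x - 1)\<close> has to exceed -1; as \<open>y x <= 1\<close>, no term loses more
  than \<open>1 - f x\<close>.\<close>

lemma weighted_sum_gt:
  fixes y f :: "'a \<Rightarrow> real"
  assumes X: "X \<noteq> {}" "finite X" "card X \<le> 3"
    and y: "\<And>x. x \<in> X \<Longrightarrow> 0 < y x \<and> y x \<le> 1"
    and f: "\<And>x. x \<in> X \<Longrightarrow> 0 \<le> f x \<and> f x \<le> 2"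
    and sum_f: "sum f X \<ge> min 3 (card X + 1)"
  shows "max 0 (sum y X - 1) < (\<Sum>x\<in>X. y x * f x)"
proof -
  have pos: "0 < (\<Sum>x\<in>X. y x * f x)"
  proof -
    have "\<exists>x\<in>X. f x \<noteq> 0"
    proof (rule ccontr)
      assume "\<not> ?thesis"
      then have "sum f X = 0" by simp
      with sum_f show False by simp
    qed
    then obtain x where "x \<in> X" "f x > 0" using f by force
    then show ?thesis using y f X(2)
      by (intro sum_pos2[of X x]) (auto intro!: mult_pos_pos mult_nonneg_nonneg simp: less_imp_le)
  qed
  have lower: "y x * (f x - 1) \<ge> min 0 (f x - 1)" 
      and strict: "f x > 1 \<Longrightarrow> y x * (f x - 1) > 0" if "x \<in> X" for x
  proof -
    show "y x * (f x - 1) \<ge> min 0 (f x - 1)"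
    proof (cases "f x \<ge> 1")
      case True
      then show ?thesis using y[OF that] by (simp add: min_def)
    next
      case False
      then have "1 * (f x - 1) \<le> y x * (f x - 1)"
        using y[OF that] by (intro mult_right_mono_neg) auto
      then show ?thesis by simp
    qed
  qed (use y[OF that] in simp)
  have "card X = 1 \<or> card X = 2 \<or> card X = 3"
    using X card_gt_0_iff[of X] by linarith
  then have "0 < (\<Sum>x\<in>X. y x * (f x - 1)) + 1"
  proof (elim disjE)
    assume "card X = 1"
    then obtain a where X: "X = {a}" by (rule card_1_singletonE)
    then have "f a \<ge> 2" using sum_f by simp
    then show ?thesis using strict[of a] X by simp
  next
    assume "card X = 2"
    then obtain a b where X: "X = {a, b}" "a \<noteq> b" by (auto simp: card_2_iff)
    then have "f a + f b \<ge> 3" using sum_f by simp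
    \<comment> \<open>The upper bound 2 on each value forces both to be at least 1.\<close>
    then have "min 0 (f a - 1) + min 0 (f b - 1) \<ge> 0"
      using f[of a] f[of b] X by simp
    then show ?thesis using lower[of a] lower[of b] X by simp
  next
    assume "card X = 3"
    then obtain a b c where X: "X = {a, b, c}" "a \<noteq> b" "a \<noteq> c" "b \<noteq> c"
      by (auto simp: card_3_iff)
    then have s: "f a + f b + f c \<ge> 3" using sum_f by simp
    have le2: "f a \<le> 2" "f b \<le> 2" "f c \<le> 2"
      and ge0: "f a \<ge> 0" "f b \<ge> 0" "f c \<ge> 0" using f X by auto
    define p where "p x = y x * (f x - 1)" for x
    have "p x \<ge> min 0 (f x - 1)" "f x > 1 \<Longrightarrow> p x > 0" if "x \<in> X" for x
      using lower[OF that] strict[OF that] by (auto simp: p_def)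
    then have "p a \<ge> min 0 (f a - 1)" "p b \<ge> min 0 (f b - 1)" "p c \<ge> min 0 (f c - 1)"
      "f a > 1 \<Longrightarrow> p a > 0" "f b > 1 \<Longrightarrow> p b > 0" "f c > 1 \<Longrightarrow> p c > 0"
      using X by auto
    \<comment> \<open>If exactly one value exceeds 1, it is at most 2, so the other two lose at most
      1 together and its own gain is strict. If two exceed 1, the third loses at most 1. If none
      does, all equal 1.\<close>
    then have "p a + p b + p c + 1 > 0"
      using s le2 ge0 by (smt (verit))
    then show ?thesis using X by (simp add: p_def)
  qed
  then show ?thesis using pos by (simp add: algebra_simps sum_subtractf)
qed

text \<open>Deleting \<open>v\<close> and its out-neighbours frees
  \<open>4 * (1 + card (out_nbrs E V v))\<close> in the bound \<open>4 * card V\<close>. This must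
  pay 3 per new source if the old quasi-kernel is kept, or 7 if \<open>v\<close> is added, for which
  one out-neighbour suffices.\<close>

lemma exists_vertex_few_new_sources:
  assumes fin: "finite V" and ne: "V \<noteq> {}" and no_src: "sources E V = {}"
    and deg: "\<And>v. v \<in> V \<Longrightarrow> card (out_nbrs E V v) \<le> 3"
  shows "\<exists>v\<in>V. out_nbrs E V v \<noteq> {} \<and>
    3 * card (sources E (V - insert v (out_nbrs E V v))) \<le> 4 * (1 + card (out_nbrs E V v))"
proof (rule ccontr)
  assume "\<not> ?thesis"
  then have bad: "4 * (1 + card (out_nbrs E V v))
      < 3 * card (sources E (V - insert v (out_nbrs E V v)))"
    if "v \<in> V" "out_nbrs E V v \<noteq> {}" for v
    using that by (auto simp: not_le)
  let ?N = "out_nbrs E V"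
  \<comment> \<open>Each vertex splits weight 1 evenly among its in-neighbours; \<open>g v\<close>
    is what \<open>v\<close> receives.\<close>
  define y :: "'a \<Rightarrow> real" where "y x = 1 / card (in_nbrs E V x)" for x
  define g where "g v = sum y (?N v)" for v
  define f where "f v = max 0 (g v - 1)" for v
  have finN: "finite (?N v)" "finite (in_nbrs E V v)" for v
    using fin by (auto simp: out_nbrs_def in_nbrs_def)
  have NV: "?N v \<subseteq> V" for v by (auto simp: out_nbrs_def)
  have indeg: "card (in_nbrs E V x) > 0" if "x \<in> V" for x
    using no_src that finN(2)[of x] by (auto simp: sources_def in_nbrs_def card_gt_0_iff)
  have y: "0 < y x \<and> y x \<le> 1" if "x \<in> V" for x
    using indeg[OF that] by (auto simp: y_def)
  have in_sum: "(\<Sum>v\<in>in_nbrs E V x. y x) = 1" if "x \<in> V" for x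
    using indeg[OF that] by (simp add: y_def)
  have g_le: "g v \<le> 3" if "v \<in> V" for v
  proof -
    have "g v \<le> real (card (?N v)) * 1"
      unfolding g_def using y NV by (intro sum_bounded_above) auto
    then show ?thesis using deg[OF that] by linarith
  qed
  have f_range: "0 \<le> f v \<and> f v \<le> 2" if "v \<in> V" for v
    using g_le[OF that] by (auto simp: f_def)
  have new_sources: "card (sources E (V - insert v (?N v))) \<le> sum g (?N v)"
    if v: "v \<in> V" for v
  proof -
    define S where "S = sources E (V - insert v (?N v))"
    have SV: "S \<subseteq> V" by (auto simp: S_def sources_def)
    then have finS: "finite S" using fin finite_subset by blast
    \<comment> \<open>All in-neighbours of a new source were deleted, and \<open>v\<close> is not
      among them because \<open>w\<close> survived.\<close>
    have S_in: "in_nbrs E V w = {x \<in> ?N v. E x w}" if "w \<in> S" for w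
      using that by (auto simp: S_def sources_def in_nbrs_def out_nbrs_def)
    have "real (card S) = (\<Sum>w\<in>S. \<Sum>x\<in>{x \<in> ?N v. E x w}. y w)"
    proof -
      have "(\<Sum>x\<in>{x \<in> ?N v. E x w}. y w) = 1" if "w \<in> S" for w
        using in_sum[of w] S_in[OF that] SV that by auto
      then have "(\<Sum>w\<in>S. \<Sum>x\<in>{x \<in> ?N v. E x w}. y w) = (\<Sum>w\<in>S. 1)"
        by (intro sum.cong) auto
      then show ?thesis by simp
    qed
    also have "\<dots> = (\<Sum>x\<in>?N v. \<Sum>w\<in>{w \<in> S. E x w}. y w)"
      by (rule sum.swap_restrict) (use finS finN in auto)
    also have "\<dots> \<le> sum g (?N v)"
      unfolding g_def
      by (intro sum_mono sum_mono2) (use finN SV y in \<open>auto simp: out_nbrs_def less_imp_le\<close>)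
    finally show ?thesis by (simp add: S_def)
  qed
  have local_gt: "f v < (\<Sum>x\<in>?N v. y x * f x)" if v: "v \<in> V" "?N v \<noteq> {}" for v
    unfolding f_def[of v] g_def[of v]
  proof (rule weighted_sum_gt)
    have "card (?N v) = 1 \<or> card (?N v) = 2 \<or> card (?N v) = 3"
      using v deg[OF v(1)] finN(1)[of v] card_gt_0_iff[of "?N v"] by linarith
    \<comment> \<open>By integrality, exceeding 4(1 + d)/3 means at least 3, 5, 6 for d = 1, 2, 3.
      The summand d is later absorbed by \<open>g x <= f x + 1\<close>.\<close>
    then have "min 3 (card (?N v) + 1) + card (?N v)
        \<le> card (sources E (V - insert v (?N v)))"
      using bad[OF v] by (elim disjE) auto
    then have "real (min 3 (card (?N v) + 1)) + card (?N v) \<le> sum g (?N v)"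
      using new_sources[OF v(1)] by linarith
    also have "\<dots> \<le> (\<Sum>x\<in>?N v. f x + 1)"
      by (intro sum_mono) (auto simp: f_def)
    also have "\<dots> = sum f (?N v) + card (?N v)" by (simp add: sum.distrib)
    finally show "real (min 3 (card (?N v) + 1)) \<le> sum f (?N v)" by simp
    show "0 < y x \<and> y x \<le> 1" "0 \<le> f x \<and> f x \<le> 2" if "x \<in> ?N v" for x
      using y f_range NV that by blast+
  qed (use v deg finN in auto)
  have "(\<Sum>v\<in>V. f v) < (\<Sum>v\<in>V. \<Sum>x\<in>?N v. y x * f x)"
  proof (rule sum_strict_mono_ex1[OF fin])
    show "\<forall>v\<in>V. f v \<le> (\<Sum>x\<in>?N v. y x * f x)"
    proof
      \<comment> \<open>Without out-neighbours both sides are 0.\<close>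
      fix v assume "v \<in> V"
      then show "f v \<le> (\<Sum>x\<in>?N v. y x * f x)"
        using local_gt[of v] by (cases "?N v = {}") (auto simp: f_def g_def)
    qed
    obtain x where "x \<in> V" using ne by blast
    then obtain v where "v \<in> V" "?N v \<noteq> {}"
      using no_src unfolding sources_def out_nbrs_def by blast
    then show "\<exists>v\<in>V. f v < (\<Sum>x\<in>?N v. y x * f x)" using local_gt by blast
  qed
  also have "\<dots> = (\<Sum>x\<in>V. \<Sum>v\<in>in_nbrs E V x. y x * f x)"
    unfolding out_nbrs_def in_nbrs_def by (rule sum.swap_restrict) (use fin in auto)
  also have "\<dots> = (\<Sum>x\<in>V. f x)"
    by (intro sum.cong refl) (simp add: sum_distrib_right[symmetric] in_sum del: sum_constant)
  finally show False by simp
qed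

section \<open>The induction on the number of vertices\<close>

text \<open>Every source must lie in \<open>Q\<close>, which the term 3|S| allows for; edgeless
  digraphs give equality. The term for the out-neighbours of sources is what pays for thinning in
  \<open>trim_sources\<close>.\<close>

lemma quasi_kernel_with_sources:
  assumes "finite V" and irrefl: "\<And>v. v \<in> V \<Longrightarrow> \<not> E v v"
    and "\<And>v. v \<in> V \<Longrightarrow> card (out_nbrs E V v) \<le> 3"
  shows "\<exists>Q. rel_quasi_kernel E V Q \<and>
    7 * card Q + 4 * card (\<Union>s\<in>sources E V. out_nbrs E V s)
      \<le> 4 * card V + 3 * card (sources E V)"
  using assms
proof (induction "card V" arbitrary: V rule: less_induct)
  case less
  note fin = less.prems(1) and irrefl = less.prems(2) and deg = less.prems(3)
  let ?N = "out_nbrs E V"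
  have IH: "\<exists>Q. rel_quasi_kernel E R Q \<and>
    7 * card Q + 4 * card (\<Union>s\<in>sources E R. out_nbrs E R s)
      \<le> 4 * card R + 3 * card (sources E R)" if "R \<subset> V" for R
  proof (rule less.hyps)
    show "card R < card V" using fin that by (rule psubset_card_mono)
    show "finite R" using that fin finite_subset by blast
    show "card (out_nbrs E R v) \<le> 3" if v: "v \<in> R" for v
    proof -
      have "card (out_nbrs E R v) \<le> card (?N v)"
        using \<open>R \<subset> V\<close> fin by (intro card_mono) (auto simp: out_nbrs_def)
      also have "\<dots> \<le> 3" using deg v \<open>R \<subset> V\<close> by blast
      finally show ?thesis .
    qed
  qed (use irrefl that in blast)
  \<comment> \<open>Shared by both deletions: \<open>I\<close> is the set of sources or a single
    vertex. No edge leads from \<open>I\<close> into \<open>R\<close>, so only edges from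
    \<open>P\<close> to \<open>I\<close> need to be excluded.\<close>
  have extend: "rel_quasi_kernel E V (P \<union> I)"
    if I: "I \<subseteq> V" "\<And>u v. u \<in> I \<Longrightarrow> v \<in> I \<Longrightarrow> \<not> E u v"
      and R: "R = V - (I \<union> (\<Union>s\<in>I. ?N s))"
      and P: "P \<subseteq> R" "\<And>u v. u \<in> P \<Longrightarrow> v \<in> P \<Longrightarrow> \<not> E u v"
        "\<And>u. u \<in> R - sources E R \<Longrightarrow> covers E R P u"
      and PI: "\<And>u v. u \<in> P \<Longrightarrow> v \<in> I \<Longrightarrow> \<not> E u v"
      and no_src: "sources E V \<subseteq> I"
    for I R P
    unfolding rel_quasi_kernel_def
  proof (intro conjI ballI)
    show "P \<union> I \<subseteq> V" using I P R by blast
    show "\<not> E u v" if "u \<in> P \<union> I" "v \<in> P \<union> I" for u v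
      using that I P(1,2) PI unfolding R out_nbrs_def by blast
    show "covers E V (P \<union> I) u" if u: "u \<in> V" for u
    proof -
      consider "u \<in> R - sources E R" | "u \<in> I" | "u \<in> (\<Union>s\<in>I. ?N s)"
        | "u \<in> sources E R" "u \<notin> I" "u \<notin> (\<Union>s\<in>I. ?N s)" using u R by blast
      then show ?thesis
      proof cases
        case 1
        then show ?thesis using P(3) R by (blast intro: covers_mono)
      next
        \<comment> \<open>An in-neighbour of \<open>u\<close> exists and was deleted; it is not in
          \<open>I\<close>, as \<open>u\<close> is no out-neighbour of \<open>I\<close>. So
          \<open>u\<close> is two steps from \<open>I\<close>.\<close>
        case 4
        then obtain x where x: "x \<in> V" "E x u"
          using no_src u unfolding sources_def by blast
        with 4 have "x \<in> (\<Union>s\<in>I. ?N s)"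
          unfolding R sources_def out_nbrs_def by blast
        then show ?thesis using x unfolding covers_def out_nbrs_def by blast
      qed (auto simp: covers_def out_nbrs_def)
    qed
  qed
  show ?case
  proof (cases "sources E V = {}")
    case False
    define S where "S = sources E V"
    define T where "T = (\<Union>s\<in>S. ?N s)"
    define R where "R = V - (S \<union> T)"
    have SV: "S \<subseteq> V" and TV: "T \<subseteq> V" and ST: "S \<inter> T = {}"
      by (auto simp: S_def T_def sources_def out_nbrs_def)
    have "R \<subset> V" using SV False by (auto simp: R_def S_def)
    then obtain Q where Q: "rel_quasi_kernel E R Q"
      "7 * card Q + 4 * card (\<Union>s\<in>sources E R. out_nbrs E R s)
        \<le> 4 * card R + 3 * card (sources E R)"
      using IH by blast
    have finR: "finite R" using fin by (simp add: R_def)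
    obtain P where P: "P \<subseteq> Q" "7 * card P \<le> 4 * card R"
      "\<And>u. u \<in> R - sources E R \<Longrightarrow> covers E R P u"
      using trim_sources[OF finR Q] by blast
    have qk: "rel_quasi_kernel E V (P \<union> S)"
    proof (rule extend[OF SV _ R_def[unfolded T_def] _ _ P(3)])
      show PR: "P \<subseteq> R" using P(1) Q(1) unfolding rel_quasi_kernel_def by blast
      show "\<not> E u w" if "u \<in> P" "w \<in> P" for u w
        using P(1) Q(1) that unfolding rel_quasi_kernel_def by blast
      have to_S: "\<not> E u w" if "u \<in> V" "w \<in> S" for u w
        using that by (simp add: S_def sources_def)
      then show "\<not> E u w" if "u \<in> S" "w \<in> S" for u w
        using SV that by blast
      show "\<not> E u w" if "u \<in> P" "w \<in> S" for u w
        using to_S PR \<open>R \<subset> V\<close> that by blast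
    qed (simp_all add: S_def)
    have "card R = card V - (card S + card T)" "card S + card T \<le> card V"
      using fin SV TV ST finite_subset[of _ V] card_Un_disjoint[of S T]
        card_mono[of V "S \<union> T"] by (auto simp: R_def card_Diff_subset)
    moreover have "card (P \<union> S) \<le> card P + card S" by (rule card_Un_le)
    \<comment> \<open>7|P| + 7|S| <= 4(|V| - |S| - |T|) + 7|S|, which is the claim.\<close>
    ultimately have "7 * card (P \<union> S) + 4 * card T \<le> 4 * card V + 3 * card S"
      using P(2) by linarith
    then show ?thesis using qk unfolding S_def T_def by blast
  next
    case no_src: True
    show ?thesis
    proof (cases "V = {}")
      case True
      then show ?thesis
        by (intro exI[of _ "{}"]) (auto simp: rel_quasi_kernel_def sources_def)
    next
      case False
      then obtain v where v: "v \<in> V" "?N v \<noteq> {}"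
        "3 * card (sources E (V - insert v (?N v))) \<le> 4 * (1 + card (?N v))"
        using exists_vertex_few_new_sources[OF fin _ no_src deg] by blast
      define R where "R = V - insert v (?N v)"
      have "R \<subset> V" using v(1) by (auto simp: R_def)
      then obtain Q where Q: "rel_quasi_kernel E R Q"
        "7 * card Q + 4 * card (\<Union>s\<in>sources E R. out_nbrs E R s)
          \<le> 4 * card R + 3 * card (sources E R)"
        using IH by blast
      have finR: "finite R" and finN: "finite (?N v)"
        using fin by (auto simp: R_def out_nbrs_def)
      have "v \<notin> ?N v" "?N v \<subseteq> V" using irrefl v(1) by (auto simp: out_nbrs_def)
      then have cardR: "card R + card (?N v) + 1 = card V"
        using fin v(1) finN card_mono[of V "insert v (?N v)"]
        by (simp add: R_def card_Diff_subset del: Diff_insert)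
      have "\<exists>Q. rel_quasi_kernel E V Q \<and> 7 * card Q \<le> 4 * card V"
      proof (cases "\<exists>q\<in>Q. E q v")
        case True
        \<comment> \<open>Through \<open>v\<close>, the vertex \<open>q\<close> reaches everything
          deleted within two steps, so \<open>Q\<close> is kept untrimmed.\<close>
        then obtain q where q: "q \<in> Q" "E q v" by blast
        have "rel_quasi_kernel E V Q"
          unfolding rel_quasi_kernel_def
        proof (intro conjI ballI)
          show "Q \<subseteq> V" using Q(1) \<open>R \<subset> V\<close> by (auto simp: rel_quasi_kernel_def)
          show "\<not> E a b" if "a \<in> Q" "b \<in> Q" for a b
            using Q(1) that by (auto simp: rel_quasi_kernel_def)
          show "covers E V Q u" if "u \<in> V" for u
          proof (cases "u \<in> R")
            case True
            then show ?thesis using Q(1) \<open>R \<subset> V\<close>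
              by (auto simp: rel_quasi_kernel_def intro: covers_mono)
          next
            case False
            then show ?thesis using q that v(1)
              by (auto simp: R_def covers_def out_nbrs_def)
          qed
        qed
        moreover have "7 * card Q \<le> 4 * card V"
        proof -
          have "7 * card Q \<le> 4 * card R + 3 * card (sources E R)"
            using Q(2) by (rule add_leD1)
          also have "\<dots> \<le> 4 * card R + 4 * (1 + card (?N v))"
            using v(3)[folded R_def] by (rule add_left_mono)
          also have "\<dots> = 4 * card V" using cardR by simp
          finally show ?thesis .
        qed
        ultimately show ?thesis by blast
      next
        case False
        obtain P where P: "P \<subseteq> Q" "7 * card P \<le> 4 * card R"
          "\<And>u. u \<in> R - sources E R \<Longrightarrow> covers E R P u"
          using trim_sources[OF finR Q] by blast
        have "rel_quasi_kernel E V (P \<union> {v})"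
        proof (rule extend[OF _ _ _ _ _ P(3)])
          show "P \<subseteq> R" using P(1) Q(1) unfolding rel_quasi_kernel_def by blast
          show "\<not> E u w" if "u \<in> P" "w \<in> P" for u w
            using P(1) Q(1) that unfolding rel_quasi_kernel_def by blast
          show "\<not> E u w" if "u \<in> P" "w \<in> {v}" for u w
            using P(1) False that by blast
        qed (use v(1) irrefl no_src in \<open>auto simp: R_def\<close>)
        moreover have "card (P \<union> {v}) \<le> card P + 1"
          using card_Un_le[of P "{v}"] by simp
        moreover have "card (?N v) \<ge> 1"
          using v(2) finN card_gt_0_iff[of "?N v"] by linarith
        \<comment> \<open>At least two vertices were deleted, so 7|P| + 7 <= 4(|V| - 2) + 7 <
          4|V|.\<close>
        ultimately show ?thesis using P(2) cardR
          by (intro exI[of _ "P \<union> {v}"]) linarith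
      qed
      then show ?thesis using no_src by simp
    qed
  qed
qed

section \<open>Transfer to digraphs and distances\<close>

lemma (in wf_digraph) ddist_le_2:
  assumes "q \<in> verts G" "covers (\<lambda>u v. u \<rightarrow>\<^bsub>G\<^esub> v) (verts G) {q} u"
  shows "ddist G q u \<le> 2"
proof -
  have "\<exists>p. apath q p u \<and> length p \<le> 2"
  proof (cases "q = u \<or> q \<rightarrow>\<^bsub>G\<^esub> u")
    case True
    then consider "q = u" | a where "q \<noteq> u" "a \<in> arcs G" "tail G a = q" "head G a = u"
      by (auto simp: arcs_ends_def arc_to_ends_def)
    then show ?thesis
    proof cases
      case 1
      then show ?thesis using assms(1) by (intro exI[of _ "[]"]) (simp add: apath_def awalk_def)
    next
      case 2
      then show ?thesis
        by (intro exI[of _ "[a]"]) (auto simp: apath_def awalk_def)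
    qed
  next
    case False
    then obtain x where "q \<rightarrow>\<^bsub>G\<^esub> x" "x \<rightarrow>\<^bsub>G\<^esub> u"
      using assms(2) by (auto simp: covers_def)
    then obtain a b where ab: "a \<in> arcs G" "tail G a = q" "head G a = x"
      "b \<in> arcs G" "tail G b = x" "head G b = u"
      by (auto simp: arcs_ends_def arc_to_ends_def)
    \<comment> \<open>An \<open>apath\<close> repeats no vertex; any coincidence here would make
      \<open>q\<close> equal to \<open>u\<close> or dominate it.\<close>
    have "q \<noteq> x" "x \<noteq> u" "q \<noteq> u"
      using False \<open>q \<rightarrow>\<^bsub>G\<^esub> x\<close> \<open>x \<rightarrow>\<^bsub>G\<^esub> u\<close> by auto
    then show ?thesis using ab
      by (intro exI[of _ "[a, b]"]) (auto simp: apath_def awalk_def)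
  qed
  then obtain p where p: "apath q p u" "length p \<le> 2" by blast
  then have "ddist G q u \<le> enat (length p)"
    unfolding ddist_def by (intro INF_lower) simp
  also have "\<dots> \<le> 2" using p(2) by (simp add: numeral_eq_enat)
  finally show ?thesis .
qed

theorem theorem1p4:
  fixes D :: "('a,'b) pre_digraph" and n :: nat
  assumes "digraph D"
    and "sourceless D"
    and "n = card (verts D)"
    and "max_out_degree D \<le> 3"
  shows "\<exists>Q. quasi_kernel D Q \<and> real (card Q) \<le> 4 * real n / 7"
proof -
  interpret digraph D by fact
  let ?E = "\<lambda>u v. u \<rightarrow>\<^bsub>D\<^esub> v"
  have "card (out_nbrs ?E (verts D) v) \<le> 3" if v: "v \<in> verts D" for v
  proof -
    have "out_nbrs ?E (verts D) v \<subseteq> head D ` out_arcs D v"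
      by (auto simp: out_nbrs_def arcs_ends_def arc_to_ends_def out_arcs_def)
    then have "card (out_nbrs ?E (verts D) v) \<le> out_degree D v"
      unfolding out_degree_def by (rule surj_card_le[OF finite_out_arcs])
    also have "\<dots> \<le> max_out_degree D"
      unfolding max_out_degree_def by (rule cSUP_upper[OF v]) simp
    finally show ?thesis using assms(4) by simp
  qed
  moreover have "\<not> ?E v v" for v
    using no_loops by (auto simp: arcs_ends_def arc_to_ends_def)
  ultimately obtain Q where Q: "rel_quasi_kernel ?E (verts D) Q"
    "7 * card Q + 4 * card (\<Union>s\<in>sources ?E (verts D). out_nbrs ?E (verts D) s)
      \<le> 4 * card (verts D) + 3 * card (sources ?E (verts D))"
    using quasi_kernel_with_sources[of "verts D" ?E] finite_verts by blast
  have "sources ?E (verts D) = {}"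
  proof -
    have "\<exists>u\<in>verts D. ?E u v" if "v \<in> verts D" for v
    proof -
      have "in_degree D v \<noteq> 0"
        using assms(2) that by (auto simp: sourceless_def source_def)
      then obtain a where "a \<in> in_arcs D v"
        unfolding in_degree_def by (metis card.empty ex_in_conv)
      then show ?thesis
        by (intro bexI[of _ "tail D a"]) (auto simp: arcs_ends_def arc_to_ends_def)
    qed
    then show ?thesis by (auto simp: sources_def)
  qed
  then have "7 * card Q \<le> 4 * n" using Q(2) assms(3) by simp
  then have "real (card Q) \<le> 4 * real n / 7" by linarith
  moreover have "quasi_kernel D Q"
    unfolding quasi_kernel_def independent_set_def
  proof (intro conjI ballI)
    fix u assume "u \<in> verts D"
    then have "covers ?E (verts D) Q u" using Q(1) by (simp add: rel_quasi_kernel_def)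
    then obtain q where "q \<in> Q" "covers ?E (verts D) {q} u"
      unfolding covers_def by blast
    moreover from this have "q \<in> verts D" using Q(1) by (auto simp: rel_quasi_kernel_def)
    ultimately show "\<exists>v\<in>Q. ddist D v u \<le> 2" using ddist_le_2 by blast
  qed (use Q(1) in \<open>auto simp: rel_quasi_kernel_def\<close>)
  ultimately show ?thesis by blast
qed

end
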